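(* For every $\alpha>1/2$ there exists $C$ such that for every positive integer $n$, every $n$-vertex graph $G$ and every edge coloring $\mathcal{F}=(F_1,\dots,F_n)$ of $G$ with $F_i\neq\emptyset$ for each $i\in\{1,\dots,n\}$, if at least $\alpha n$ of the color classes in $\mathcal{F}$ are matchings of size $2$, then $rgirth(\mathcal{F})\le C\log n$.
   Context: Graphs are finite and simple. An edge coloring of a graph $G$ is a family $\mathcal{F}=(F_1,\dots,F_m)$ of pairwise disjoint nonempty sets of edges with $\bigcup_{i=1}^m F_i=E(G)$; the indices $i$ are the colors and the sets $F_i$ are the color classes. A set of edges $F$ is rainbow for $\mathcal{F}$ if its edges are taken from distinct $F_i$'s, i.e. $|F\cap F_i|\le 1$ for each $i$. The rainbow girth $rgirth(\mathcal{F})$ is the minimum length of a cycle in $G$ whose edge set is rainbow ($\infty$ if there is none). *)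

theory Defs
  imports Complex_Main "HOL-Library.Extended_Real" "HOL-Library.Disjoint_Sets"
begin

definition simple_graph :: "'a set \<Rightarrow> 'a set set \<Rightarrow> bool" where
  "simple_graph V E \<longleftrightarrow> finite V \<and> (\<forall>e\<in>E. e \<subseteq> V \<and> card e = 2)"

definition matching :: "'a set set \<Rightarrow> bool" where
  "matching M \<longleftrightarrow> (\<forall>e\<in>M. \<forall>f\<in>M. e \<noteq> f \<longrightarrow> e \<inter> f = {})"

definition edge_coloring :: "'a set set \<Rightarrow> nat \<Rightarrow> (nat \<Rightarrow> 'a set set) \<Rightarrow> bool" where
  "edge_coloring E m F \<longleftrightarrow>
     (\<forall>i\<in>{1..m}. F i \<noteq> {}) \<and> disjoint_family_on F {1..m} \<and> (\<Union>i\<in>{1..m}. F i) = E"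

definition rainbow :: "nat \<Rightarrow> (nat \<Rightarrow> 'a set set) \<Rightarrow> 'a set set \<Rightarrow> bool" where
  "rainbow m F S \<longleftrightarrow> (\<forall>i\<in>{1..m}. card (S \<inter> F i) \<le> 1)"

text \<open>A cycle is given by the list of its vertices in cyclic order, without repeating the
  first vertex at the end, so the length of the list is the length of the cycle.\<close>

definition cycle_edges :: "'a list \<Rightarrow> 'a set set" where
  "cycle_edges vs = {{vs ! i, vs ! (Suc i mod length vs)} | i. i < length vs}"

definition is_cycle :: "'a set \<Rightarrow> 'a set set \<Rightarrow> 'a list \<Rightarrow> bool" where
  "is_cycle V E vs \<longleftrightarrow>
     3 \<le> length vs \<and> distinct vs \<and> set vs \<subseteq> V \<and> cycle_edges vs \<subseteq> E"

text \<open>The infimum in \<^typ>\<open>enat\<close> is attained for a nonempty set and is \<open>\<infinity>\<close> for the empty set.\<close>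

definition rgirth :: "'a set \<Rightarrow> 'a set set \<Rightarrow> nat \<Rightarrow> (nat \<Rightarrow> 'a set set) \<Rightarrow> enat" where
  "rgirth V E m F =
     Inf {enat (length vs) | vs. is_cycle V E vs \<and> rainbow m F (cycle_edges vs)}"

end

theory Submission
  imports Defs
begin

text \<open>
  The condition \<open>\<alpha> > 1/2\<close> leaves at least \<open>(2\<alpha> - 1) n\<close> vertices untouched by one chosen edge from
  each color class that is not a matching of size 2. Linearly many of these lie on boundedly many
  colors, so a linear-sized set \<open>W\<close> of them meets every matching of size 2 in at most one vertex; each
  such matching then has an edge avoiding \<open>W\<close>. The chosen edges form a rainbow graph with \<open>n\<close> edges on
  at most \<open>(1 - c) n\<close> vertices. In a minimal vertex set inducing at least \<open>1 + c\<close> times as many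
  edges as vertices, every set \<open>X\<close> is touched by at least \<open>(1 + c) |X|\<close> edges, so balls grow
  exponentially until a cycle closes, which happens at radius \<open>O(log n)\<close>.
\<close>

section \<open>Cycles from paths\<close>

text \<open>Lists of vertices. The empty list and all one-vertex lists count as paths, so later
  statements ask for nonempty lists separately.\<close>

definition path :: "'a set set \<Rightarrow> 'a list \<Rightarrow> bool" where
  "path E p \<longleftrightarrow> distinct p \<and> successively (\<lambda>x y. {x, y} \<in> E) p"

lemma is_cycleI:
  assumes "path E vs" "3 \<le> length vs" "{last vs, hd vs} \<in> E"
  shows "is_cycle (\<Union>E) E vs"
proof -
  have edge: "{vs ! i, vs ! (Suc i mod length vs)} \<in> E" if "i < length vs" for i
  proof (cases "Suc i < length vs")
    case True
    then show ?thesis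
      using assms(1) by (simp add: path_def successively_conv_nth)
  next
    case False
    then have "Suc i = length vs" using that by simp
    then have "i = length vs - 1" by simp
    moreover have "vs \<noteq> []" using assms(2) by auto
    ultimately show ?thesis
      using assms(3) \<open>Suc i = length vs\<close> by (simp add: last_conv_nth hd_conv_nth)
  qed
  then have "set vs \<subseteq> \<Union>E"
    by (metis UnionI in_set_conv_nth insertI1 subsetI)
  with edge show ?thesis
    using assms by (auto simp: is_cycle_def cycle_edges_def path_def)
qed

lemma is_cycle_mono:
  assumes "is_cycle V E vs" "V \<subseteq> V'" "E \<subseteq> E'"
  shows "is_cycle V' E' vs"
  using assms unfolding is_cycle_def by blast

lemma path_rev: "path E (rev p) = path E p"
  by (simp add: path_def insert_commute)

lemma path_appendD1: "path E (p @ q) \<Longrightarrow> path E p"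
  and path_appendD2: "path E (p @ q) \<Longrightarrow> path E q"
  by (auto simp: path_def successively_append_iff)

text \<open>Strip the common start of the two paths. From the point where they diverge, follow
  \<open>p\<close> to its first vertex on \<open>q\<close> and return along \<open>q\<close>. The
  branching vertex and the meeting vertex lie on both paths but occur once in the cycle, which
  accounts for the 2.\<close>

lemma cycle_from_two_paths:
  assumes "path E p" "path E q" "p \<noteq> []" "q \<noteq> []"
    and "hd p = hd q" "last p = last q" "p \<noteq> q"
  shows "\<exists>vs. is_cycle (\<Union>E) E vs \<and> length vs + 2 \<le> length p + length q"
  using assms
proof (induction p arbitrary: q)
  case Nil
  then show ?case by simp
next
  case (Cons x p' q)
  from Cons.prems obtain q' where q: "q = x # q'"
    by (cases q) auto
  \<comment> \<open>By distinctness \<open>[x]\<close> is the only path from \<open>x\<close> to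
    \<open>x\<close>, so an empty remainder on one side would force \<open>p = q\<close>.\<close>
  have ne: "p' \<noteq> []" "q' \<noteq> []"
    using Cons.prems unfolding q
    by (metis distinct.simps(2) last.simps last_in_set path_def)+
  have last: "last p' = last q'"
    using Cons.prems ne by (simp add: q)
  have paths: "path E p'" "path E q'" and x: "x \<notin> set p'" "x \<notin> set q'"
    and edges: "{x, hd p'} \<in> E" "{x, hd q'} \<in> E"
    using Cons.prems ne by (auto simp: q path_def successively_Cons)
  show ?case
  proof (cases "hd p' = hd q'")
    case True
    then obtain vs where "is_cycle (\<Union>E) E vs" "length vs + 2 \<le> length p' + length q'"
      using Cons.IH[OF paths ne True last] Cons.prems by (auto simp: q)
    then show ?thesis by (intro exI[of _ vs]) (simp add: q)
  next
    case False
    \<comment> \<open>The common endpoint shows that the paths meet again; taking the first such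
      vertex keeps \<open>p1\<close> disjoint from \<open>q'\<close>.\<close>
    have "\<exists>z\<in>set p'. z \<in> set q'"
      using ne last by (metis last_in_set)
    from split_list_first_prop[OF this] obtain p1 z p2
      where p': "p' = p1 @ z # p2" and z: "z \<in> set q'" and p1: "\<forall>y\<in>set p1. y \<notin> set q'"
      by blast
    from z obtain q1 q2 where q': "q' = q1 @ z # q2"
      by (meson split_list)
    let ?vs = "(x # p1) @ z # rev q1"
    have pz: "path E (x # p1 @ [z])"
      using Cons.prems(1) path_appendD1[of E "x # p1 @ [z]" p2] by (simp add: p')
    have "path E (q1 @ [z])"
      using paths(2) path_appendD1[of E "q1 @ [z]" q2] by (simp add: q')
    then have "path E (z # rev q1)"
      using path_rev[of E "q1 @ [z]"] by simp
    with pz have "path E ?vs"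
      using p1 x by (auto simp: path_def successively_append_iff successively_Cons hd_append q')
    \<comment> \<open>Otherwise both paths would step from \<open>x\<close> directly to
      \<open>z\<close>, against the case assumption.\<close>
    moreover have "p1 \<noteq> [] \<or> q1 \<noteq> []"
      using False by (auto simp: p' q')
    then have "3 \<le> length ?vs"
      by (cases p1; cases q1) auto
    moreover have "last ?vs = hd q'"
      by (cases q1) (auto simp: q')
    then have "{last ?vs, hd ?vs} \<in> E"
      using edges(2) by (simp add: insert_commute)
    ultimately have "is_cycle (\<Union>E) E ?vs"
      by (rule is_cycleI)
    then show ?thesis
      by (intro exI[of _ ?vs]) (simp add: q p' q')
  qed
qed

section \<open>Growth of balls\<close>

text \<open>The ball of radius \<open>k\<close> in graph distance: at most \<open>Suc k\<close>
  vertices means at most \<open>k\<close> edges. Paths serve as witnesses because two of them with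
  common ends produce a cycle.\<close>

definition ball_at :: "'a set set \<Rightarrow> 'a \<Rightarrow> nat \<Rightarrow> 'a set" where
  "ball_at E v k = {x. \<exists>p. path E p \<and> p \<noteq> [] \<and> hd p = v \<and> last p = x \<and> length p \<le> Suc k}"

lemma ball_at_0: "ball_at E v 0 = {v}"
proof -
  have "\<exists>p. path E p \<and> p \<noteq> [] \<and> hd p = v \<and> last p = v \<and> length p \<le> Suc 0"
    by (intro exI[of _ "[v]"]) (simp add: path_def)
  moreover have "last p = hd p" if "length p \<le> Suc 0" "p \<noteq> []" for p :: "'a list"
    using that by (cases p) auto
  ultimately show ?thesis
    unfolding ball_at_def by blast
qed

lemma ball_at_mono: "k \<le> l \<Longrightarrow> ball_at E v k \<subseteq> ball_at E v l"
proof -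
  assume "k \<le> l"
  then have "length p \<le> Suc k \<Longrightarrow> length p \<le> Suc l" for p :: "'a list"
    by simp
  then show "ball_at E v k \<subseteq> ball_at E v l"
    unfolding ball_at_def by blast
qed

lemma centre_in_ball_at: "v \<in> ball_at E v k"
  using ball_at_mono[of 0 k E v] by (auto simp: ball_at_0)

lemma ball_at_subset: "ball_at E v k \<subseteq> insert v (\<Union>E)"
proof
  fix x assume "x \<in> ball_at E v k"
  then obtain p where p: "path E p" "p \<noteq> []" "hd p = v" "last p = x"
    by (auto simp: ball_at_def)
  show "x \<in> insert v (\<Union>E)"
  proof (cases p rule: rev_cases)
    case (snoc q y)
    then show ?thesis
      using p by (cases "q = []") (auto simp: path_def successively_append_iff)
  qed (use p in simp)
qed

lemma ball_at_neighbor: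
  assumes x: "x \<in> ball_at E v k" and e: "{x, y} \<in> E"
  shows "y \<in> ball_at E v (Suc k)"
proof -
  obtain p where p: "path E p" "p \<noteq> []" "hd p = v" "last p = x" "length p \<le> Suc k"
    using x by (auto simp: ball_at_def)
  show ?thesis
  \<comment> \<open>Appending \<open>y\<close> to a path that already visits it would break
    distinctness; then the part of \<open>p\<close> up to \<open>y\<close> serves instead.\<close>
  proof (cases "y \<in> set p")
    case True
    then obtain q r where pqr: "p = q @ y # r"
      by (meson split_list)
    then have "path E (q @ [y])"
      using p(1) path_appendD1[of E "q @ [y]" r] by simp
    moreover have "hd (q @ [y]) = v"
      using p by (cases q) (auto simp: pqr)
    ultimately show ?thesis
      using p(5) unfolding ball_at_def pqr
      by (intro CollectI exI[of _ "q @ [y]"]) auto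
  next
    case False
    then have "path E (p @ [y])"
      using p e by (auto simp: path_def successively_append_iff)
    then show ?thesis
      using p unfolding ball_at_def by (intro CollectI exI[of _ "p @ [y]"]) auto
  qed
qed

text \<open>Without short cycles, every edge touching the smaller ball is the last edge of the path chosen
  to one of its endpoints, so there are fewer such edges than vertices in the larger ball.\<close>

lemma card_edges_touching_ball:
  assumes card2: "\<And>e. e \<in> E \<Longrightarrow> card e = 2"
    and fin: "finite (ball_at E v (Suc k))"
    and no_cycle: "\<And>vs. is_cycle (\<Union>E) E vs \<Longrightarrow> length vs > 2 * k + 3"
  shows "card {e \<in> E. e \<inter> ball_at E v k \<noteq> {}} < card (ball_at E v (Suc k))"
proof -
  let ?B = "ball_at E v (Suc k)"
  have "\<forall>x\<in>?B. \<exists>p. path E p \<and> p \<noteq> [] \<and> hd p = v \<and> last p = x \<and> length p \<le> k + 2"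
    by (auto simp: ball_at_def)
  then obtain P where P: "\<And>x. x \<in> ?B \<Longrightarrow>
      path E (P x) \<and> P x \<noteq> [] \<and> hd (P x) = v \<and> last (P x) = x \<and> length (P x) \<le> k + 2"
    by metis
  \<comment> \<open>Meaningless at \<open>z = v\<close>, where the chosen path is
    \<open>[v]\<close>. Leaving out the centre makes the final inequality strict.\<close>
  define last_edge where "last_edge z = {last (butlast (P z)), z}" for z
  have "{e \<in> E. e \<inter> ball_at E v k \<noteq> {}} \<subseteq> last_edge ` (?B - {v})"
  proof
    fix e assume "e \<in> {e \<in> E. e \<inter> ball_at E v k \<noteq> {}}"
    then obtain x where e: "e \<in> E" "x \<in> e" and xk: "x \<in> ball_at E v k" by blast
    obtain y where exy: "e = {x, y}" "x \<noteq> y"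
      using card2[OF e(1)] e(2) by (auto simp: card_2_iff)
    have xB: "x \<in> ?B" using xk ball_at_mono[of k "Suc k" E v] by auto
    have yB: "y \<in> ?B" using ball_at_neighbor[OF xk] e exy by blast
    note Px = P[OF xB] and Py = P[OF yB]
    show "e \<in> last_edge ` (?B - {v})"
    proof (cases "y \<in> set (P x)")
      case False
      \<comment> \<open>Two paths from \<open>v\<close> to \<open>y\<close> with at most
        \<open>k + 3\<close> and \<open>k + 2\<close> vertices: if different, they would give a
        cycle of length at most \<open>2 * k + 3\<close>.\<close>
      have "path E (P x @ [y])"
        using Px False e exy by (auto simp: path_def successively_append_iff)
      moreover have "\<not> (\<exists>vs. is_cycle (\<Union>E) E vs \<and> length vs + 2 \<le> length (P x @ [y]) + length (P y))"
        using no_cycle Px Py by fastforce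
      ultimately have "P x @ [y] = P y"
        using cycle_from_two_paths[of E "P x @ [y]" "P y"] Px Py by auto
      then have "butlast (P y) = P x"
        by (metis butlast_snoc)
      then have "last_edge y = e"
        using Px by (simp add: last_edge_def exy)
      moreover have "y \<noteq> v"
        using False Px by (metis hd_in_set)
      ultimately show ?thesis using yB by blast
    next
      case True
      then obtain q r where pqr: "P x = q @ y # r"
        by (meson split_list)
      have r: "r \<noteq> []" "last r = x"
        using Px exy(2) by (auto simp: pqr split: if_splits)
      \<comment> \<open>The rest of \<open>P x\<close> after reaching \<open>y\<close> competes with
        the single edge from \<open>y\<close> to \<open>x\<close>; without a short cycle they agree,
        so \<open>e\<close> ends \<open>P x\<close>.\<close>
      have yr: "path E (y # r)"
        using Px path_appendD2[of E q "y # r"] by (simp add: pqr)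
      have "path E [y, x]"
        using e exy by (simp add: path_def insert_commute)
      moreover have "\<not> (\<exists>vs. is_cycle (\<Union>E) E vs \<and> length vs + 2 \<le> length (y # r) + length [y, x])"
        using no_cycle Px by (fastforce simp: pqr)
      ultimately have "y # r = [y, x]"
        using cycle_from_two_paths[of E "y # r" "[y, x]"] yr r by auto
      then have Pq: "P x = q @ [y, x]"
        using pqr by simp
      then have "last_edge x = e"
        by (simp add: last_edge_def exy butlast_append insert_commute)
      moreover have "x \<noteq> v"
      proof
        assume "x = v"
        then have "hd (P x) = x" using Px by simp
        then show False
          using Px exy(2) by (cases q) (auto simp: Pq path_def)
      qed
      ultimately show ?thesis using xB by blast
    qed
  qed
  then have "card {e \<in> E. e \<inter> ball_at E v k \<noteq> {}} \<le> card (?B - {v})"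
    using fin by (meson card_image_le card_mono finite_Diff finite_imageI le_trans)
  also have "\<dots> < card ?B"
    using fin by (intro psubset_card_mono) (use centre_in_ball_at[of v E "Suc k"] in auto)
  finally show ?thesis .
qed

section \<open>Short cycles in graphs with linearly many excess edges\<close>

text \<open>Without a short cycle, the next ball has more vertices than there are edges touching the
  current one. Each step thus multiplies the size by at least \<open>1 + \<delta>\<close>, and
  \<open>K\<close> steps would outgrow \<open>U\<close>.\<close>

lemma cycle_in_touched_graph:
  fixes \<delta> :: real
  assumes "finite U" "v \<in> U" and edges: "\<And>e. e \<in> E \<Longrightarrow> e \<subseteq> U \<and> card e = 2"
    and touch: "\<And>X. X \<subseteq> U \<Longrightarrow> X \<noteq> {} \<Longrightarrow> real (card {e \<in> E. e \<inter> X \<noteq> {}}) \<ge> (1 + \<delta>) * card X"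
    and "\<delta> > 0" and big: "(1 + \<delta>) ^ K > card U"
  shows "\<exists>vs. is_cycle (\<Union>E) E vs \<and> length vs \<le> 2 * K + 1"
proof (rule ccontr)
  assume "\<not> ?thesis"
  then have no_cycle: "\<And>vs. is_cycle (\<Union>E) E vs \<Longrightarrow> length vs > 2 * K + 1"
    by (meson not_le)
  have sub: "ball_at E v k \<subseteq> U" for k
    using ball_at_subset[of E v k] edges \<open>v \<in> U\<close> by blast
  have fin: "finite (ball_at E v k)" for k
    using sub \<open>finite U\<close> by (rule finite_subset)
  have "k \<le> K \<Longrightarrow> (1 + \<delta>) ^ k \<le> card (ball_at E v k)" for k
  proof (induction k)
    case 0
    then show ?case by (simp add: ball_at_0)
  next
    case (Suc k)
    have "(1 + \<delta>) ^ Suc k \<le> (1 + \<delta>) * card (ball_at E v k)"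
      using Suc \<open>\<delta> > 0\<close> by simp
    also have "\<dots> \<le> card {e \<in> E. e \<inter> ball_at E v k \<noteq> {}}"
      by (rule touch) (use sub centre_in_ball_at[of v E k] in auto)
    also have "card {e \<in> E. e \<inter> ball_at E v k \<noteq> {}} < card (ball_at E v (Suc k))"
    proof (rule card_edges_touching_ball)
      show "length vs > 2 * k + 3" if "is_cycle (\<Union>E) E vs" for vs
        using no_cycle[OF that] Suc.prems by linarith
    qed (use edges fin in auto)
    finally show ?case by simp
  qed
  from this[of K] have "(1 + \<delta>) ^ K \<le> card U"
    using card_mono[OF \<open>finite U\<close> sub[of K]] by simp
  with big show False by simp
qed

text \<open>Pass to a smallest vertex set \<open>Y\<close> with edge density at least
  \<open>1 + \<delta>\<close>. Deleting a nonempty \<open>X\<close> from \<open>Y\<close> leaves a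
  set of at most this density, so the lost edges, which are those touching \<open>X\<close>, number
  at least \<open>(1 + \<delta>) * card X\<close>.\<close>

lemma short_cycle_if_excess_edges:
  fixes \<delta> :: real
  assumes "finite U" "U \<noteq> {}" and edges: "\<And>e. e \<in> E \<Longrightarrow> e \<subseteq> U \<and> card e = 2"
    and dense: "real (card E) \<ge> (1 + \<delta>) * card U"
    and "\<delta> > 0" and big: "(1 + \<delta>) ^ K > card U"
  shows "\<exists>vs. is_cycle U E vs \<and> length vs \<le> 2 * K + 1"
proof -
  define ind where "ind X = {e \<in> E. e \<subseteq> X}" for X
  define good where "good X \<longleftrightarrow> X \<subseteq> U \<and> X \<noteq> {} \<and> real (card (ind X)) \<ge> (1 + \<delta>) * card X" for X
  have "ind U = E" using edges by (auto simp: ind_def)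
  then have "good U" using assms by (simp add: good_def)
  then obtain Y where Y: "good Y" and min: "\<And>Z. good Z \<Longrightarrow> card Y \<le> card Z"
    using ex_has_least_nat[of good U card] by blast
  have YU: "Y \<subseteq> U" "Y \<noteq> {}" "finite Y"
    using Y \<open>finite U\<close> by (auto simp: good_def finite_subset)
  have finE: "finite E"
    using edges \<open>finite U\<close> by (intro finite_subset[of E "Pow U"]) auto
  obtain v where v: "v \<in> Y" using YU by blast
  have "\<exists>vs. is_cycle (\<Union>(ind Y)) (ind Y) vs \<and> length vs \<le> 2 * K + 1"
  proof (rule cycle_in_touched_graph[OF \<open>finite Y\<close> v _ _ \<open>\<delta> > 0\<close>])
    show "e \<subseteq> Y \<and> card e = 2" if "e \<in> ind Y" for e
      using that edges by (auto simp: ind_def)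
    have "card Y \<le> card U" using YU \<open>finite U\<close> by (simp add: card_mono)
    then show "(1 + \<delta>) ^ K > card Y" using big by simp
  next
    fix X assume X: "X \<subseteq> Y" "X \<noteq> {}"
    have fin: "finite X" using X YU finite_subset by blast
    let ?T = "{e \<in> ind Y. e \<inter> X \<noteq> {}}"
    have "ind Y = ?T \<union> ind (Y - X)" "?T \<inter> ind (Y - X) = {}"
      by (auto simp: ind_def)
    moreover have "finite ?T" "finite (ind (Y - X))"
      using finE by (auto simp: ind_def)
    ultimately have split: "card (ind Y) = card ?T + card (ind (Y - X))"
      by (metis card_Un_disjoint)
    have card: "card (Y - X) = card Y - card X" "card X \<le> card Y" "card X > 0"
      using X YU fin by (auto simp: card_Diff_subset card_mono card_gt_0_iff)
    have "real (card (ind (Y - X))) \<le> (1 + \<delta>) * card (Y - X)"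
    \<comment> \<open>Minimality says nothing about the empty set, which is not \<open>good\<close>;
      it induces no edges.\<close>
    proof (cases "Y - X = {}")
      case True
      have "ind {} = {}" using edges by (fastforce simp: ind_def)
      then show ?thesis unfolding True by simp
    next
      case False
      have "\<not> good (Y - X)" using min[of "Y - X"] card by auto
      then show ?thesis using False YU by (auto simp: good_def)
    qed
    moreover have "real (card (Y - X)) = real (card Y) - real (card X)"
      using card by simp
    moreover have "real (card (ind Y)) \<ge> (1 + \<delta>) * card Y"
      using Y by (simp add: good_def)
    ultimately show "real (card ?T) \<ge> (1 + \<delta>) * card X"
      using split by (simp add: algebra_simps)
  qed
  then obtain vs where vs: "is_cycle (\<Union>(ind Y)) (ind Y) vs" "length vs \<le> 2 * K + 1"
    by blast
  have "is_cycle U E vs"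
    by (rule is_cycle_mono[OF vs(1)]) (use edges in \<open>auto simp: ind_def\<close>)
  with vs(2) show ?thesis by blast
qed

section \<open>A sparse set of vertices\<close>

text \<open>A maximal set \<open>W\<close> with pairwise disjoint color sets dominates: every other vertex of
  \<open>U\<close> shares a color with some vertex of \<open>W\<close>.\<close>

lemma exists_conflict_free_subset:
  fixes M :: "'i set" and A :: "'i \<Rightarrow> 'a set"
  assumes "finite U"
    and finA: "\<And>i. i \<in> M \<Longrightarrow> finite (A i)" and cardA: "\<And>i. i \<in> M \<Longrightarrow> card (A i) \<le> r"
    and deg: "\<And>v. v \<in> U \<Longrightarrow> finite {i \<in> M. v \<in> A i} \<and> card {i \<in> M. v \<in> A i} \<le> D"
  shows "\<exists>W\<subseteq>U. (\<forall>i\<in>M. \<forall>v\<in>W. \<forall>w\<in>W. v \<in> A i \<longrightarrow> w \<in> A i \<longrightarrow> v = w)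
           \<and> card U \<le> card W * (D * r + 1)"
proof -
  define ok where "ok W \<longleftrightarrow> W \<subseteq> U \<and> (\<forall>i\<in>M. \<forall>v\<in>W. \<forall>w\<in>W. v \<in> A i \<longrightarrow> w \<in> A i \<longrightarrow> v = w)" for W
  have "finite {W. ok W}"
    by (rule finite_subset[of _ "Pow U"]) (use \<open>finite U\<close> in \<open>auto simp: ok_def\<close>)
  moreover have "{} \<in> {W. ok W}" by (simp add: ok_def)
  ultimately obtain W where W: "ok W" and max: "\<And>W'. ok W' \<Longrightarrow> W \<subseteq> W' \<Longrightarrow> W = W'"
    using finite_has_maximal2[of "{W. ok W}" "{}"] by blast
  have WU: "W \<subseteq> U" "finite W"
    using W \<open>finite U\<close> by (auto simp: ok_def finite_subset)
  \<comment> \<open>The vertices that \<open>w\<close> excludes: itself and those sharing a color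
    with it. At most \<open>D\<close> colors with at most \<open>r\<close> vertices each give
    \<open>D * r + 1\<close>.\<close>
  define near where "near w = insert w (\<Union>i\<in>{i \<in> M. w \<in> A i}. A i)" for w
  have "U \<subseteq> (\<Union>w\<in>W. near w)"
  proof
    fix u assume u: "u \<in> U"
    show "u \<in> (\<Union>w\<in>W. near w)"
    proof (cases "u \<in> W")
      case True
      then show ?thesis by (auto simp: near_def)
    next
      case False
      then have "\<not> ok (insert u W)" using max[of "insert u W"] by blast
      then obtain i w where "i \<in> M" "w \<in> W" "u \<in> A i" "w \<in> A i"
        using W u by (auto simp: ok_def)
      then show ?thesis by (auto simp: near_def)
    qed
  qed
  moreover have near: "finite (near w)" "card (near w) \<le> D * r + 1" if "w \<in> W" for w
  proof -
    let ?I = "{i \<in> M. w \<in> A i}"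
    have I: "finite ?I" "card ?I \<le> D" using deg that WU by auto
    then show "finite (near w)" using finA by (auto simp: near_def)
    have "card (\<Union>i\<in>?I. A i) \<le> (\<Sum>i\<in>?I. card (A i))"
      using I(1) by (rule card_UN_le)
    also have "\<dots> \<le> card ?I * r"
      using sum_bounded_above[of ?I "\<lambda>i. card (A i)" r] cardA by auto
    also have "\<dots> \<le> D * r" using I by simp
    finally have "card (\<Union>i\<in>?I. A i) \<le> D * r" .
    moreover have "finite (\<Union>i\<in>?I. A i)" using I(1) finA by auto
    ultimately show "card (near w) \<le> D * r + 1"
      unfolding near_def by (subst card_insert_if) auto
  qed
  ultimately have "card U \<le> card (\<Union>w\<in>W. near w)"
    using WU by (intro card_mono) auto
  also have "\<dots> \<le> (\<Sum>w\<in>W. card (near w))"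
    using WU by (intro card_UN_le)
  also have "\<dots> \<le> card W * (D * r + 1)"
    using sum_bounded_above[of W "\<lambda>w. card (near w)" "D * r + 1"] near by auto
  finally show ?thesis using W unfolding ok_def by blast
qed

text \<open>Double counting of incidences \<open>v \<in> A i\<close>: each vertex of high degree
  contributes at least \<open>D\<close>, each index at most \<open>r\<close>.\<close>

lemma card_high_degree_le:
  fixes A :: "'i \<Rightarrow> 'a set"
  assumes "finite X" "finite M" and fin: "\<And>i. i \<in> M \<Longrightarrow> finite (A i)"
    and card: "\<And>i. i \<in> M \<Longrightarrow> card (A i) \<le> r"
  shows "D * card {v \<in> X. card {i \<in> M. v \<in> A i} > D} \<le> r * card M"
proof -
  let ?H = "{v \<in> X. card {i \<in> M. v \<in> A i} > D}"
  have "D * card ?H \<le> (\<Sum>v\<in>?H. card {i \<in> M. v \<in> A i})"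
    using sum_bounded_below[of ?H D "\<lambda>v. card {i \<in> M. v \<in> A i}"] by (simp add: mult.commute)
  also have "\<dots> = (\<Sum>v\<in>?H. \<Sum>i\<in>M. if v \<in> A i then 1 else 0)"
    using \<open>finite M\<close> by (intro sum.cong) (auto simp: sum.If_cases Int_def)
  also have "\<dots> = (\<Sum>i\<in>M. \<Sum>v\<in>?H. if v \<in> A i then 1 else 0)"
    by (rule sum.swap)
  also have "\<dots> \<le> (\<Sum>i\<in>M. card (A i))"
  proof (rule sum_mono)
    fix i assume i: "i \<in> M"
    have "(\<Sum>v\<in>?H. if v \<in> A i then 1 else 0) = card {v \<in> ?H. v \<in> A i}"
      using \<open>finite X\<close> by (auto simp: sum.If_cases Int_def)
    also have "\<dots> \<le> card (A i)"
      using fin[OF i] by (intro card_mono) auto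
    finally show "(\<Sum>v\<in>?H. if v \<in> A i then 1 else 0) \<le> card (A i)" .
  qed
  also have "\<dots> \<le> r * card M"
    using sum_bounded_above[of M "\<lambda>i. card (A i)" r] card by (simp add: mult.commute)
  finally show ?thesis .
qed

section \<open>A dense rainbow subgraph\<close>

text \<open>Vertices of edges fixed for the other colors are kept out of \<open>W\<close>. In its
  size bound, the factor 2 pays for dropping vertices on more than \<open>D\<close> colors of
  \<open>M\<close>, and \<open>4 * D + 1\<close> for removing conflicts, as a matching of size 2 has
  at most four vertices.\<close>

lemma exists_rainbow_choice:
  fixes \<alpha> \<beta> :: real and D :: nat
  assumes graph: "simple_graph V E" and "card V = n" and coloring: "edge_coloring E n F"
    and many: "real (card {i\<in>{1..n}. matching (F i) \<and> card (F i) = 2}) \<ge> \<alpha> * n"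
    and \<beta>: "\<beta> = 2 * \<alpha> - 1" "\<beta> > 0" and D: "D * \<beta> \<ge> 8"
  shows "\<exists>W h. W \<subseteq> V \<and> real (card W) * (2 * (4 * real D + 1)) \<ge> \<beta> * n
           \<and> (\<forall>i\<in>{1..n}. h i \<in> F i \<and> h i \<inter> W = {})"
proof -
  define M where "M = {i\<in>{1..n}. matching (F i) \<and> card (F i) = 2}"
  define A where "A i = \<Union>(F i)" for i
  have finV: "finite V" and E: "\<And>e. e \<in> E \<Longrightarrow> e \<subseteq> V \<and> card e = 2"
    using graph by (auto simp: simple_graph_def)
  have FE: "F i \<subseteq> E" "F i \<noteq> {}" if "i \<in> {1..n}" for i
    using coloring that by (auto simp: edge_coloring_def)
  have M: "M \<subseteq> {1..n}" "finite M" by (auto simp: M_def)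
  have cardM: "card M \<le> n" "\<alpha> * n \<le> card M"
    using card_mono[OF _ M(1)] many by (auto simp: M_def)
  have A: "finite (A i)" "card (A i) \<le> 4" if "i \<in> M" for i
  proof -
    have "A i \<subseteq> V" using FE that M E unfolding A_def by blast
    then show "finite (A i)" using finV by (rule finite_subset)
    have "card (A i) \<le> (\<Sum>e\<in>F i. card e)"
      unfolding A_def by (rule card_Union_le_sum_card)
    also have "\<dots> = (\<Sum>e\<in>F i. 2)"
      using FE that M E by (intro sum.cong) blast+
    also have "\<dots> = 4" using that by (simp add: M_def)
    finally show "card (A i) \<le> 4" .
  qed
  obtain g where g: "\<And>i. i \<in> {1..n} \<Longrightarrow> g i \<in> F i"
  proof -
    have "\<forall>i\<in>{1..n}. \<exists>e. e \<in> F i" using FE(2) by blast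
    from bchoice[OF this] show ?thesis using that by blast
  qed
  \<comment> \<open>Each color outside \<open>M\<close> spends at most two vertices, so
    \<open>T\<close> has at most \<open>2 * (1 - \<alpha>) * n\<close> of them and
    \<open>\<beta> * n\<close> remain.\<close>
  define T where "T = (\<Union>i\<in>{1..n} - M. g i)"
  have gE: "g i \<subseteq> V \<and> card (g i) = 2" if "i \<in> {1..n}" for i
    using E FE g that by blast
  have T: "T \<subseteq> V" using gE unfolding T_def by blast
  have "card T \<le> (\<Sum>i\<in>{1..n} - M. card (g i))"
    unfolding T_def by (rule card_UN_le) simp
  also have "\<dots> = (\<Sum>i\<in>{1..n} - M. 2)"
    using gE by (intro sum.cong) auto
  also have "\<dots> = 2 * (n - card M)"
    using M by (simp add: card_Diff_subset)
  finally have "card T + 2 * card M \<le> 2 * n"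
    using cardM(1) by linarith
  then have "real (card T) + 2 * real (card M) \<le> 2 * real n"
    by linarith
  then have "real (card T) \<le> 2 * real n - 2 * (\<alpha> * n)"
    using cardM(2) by linarith
  moreover have "real (card (V - T)) = real n - card T"
    using T finV \<open>card V = n\<close>
    by (metis card_Diff_subset card_mono finite_subset of_nat_diff)
  ultimately have VT: "real (card (V - T)) \<ge> \<beta> * n"
    by (simp add: \<beta> algebra_simps)
  define U where "U = {v \<in> V - T. card {i \<in> M. v \<in> A i} \<le> D}"
  let ?H = "{v \<in> V - T. card {i \<in> M. v \<in> A i} > D}"
  have "D * card ?H \<le> 4 * card M"
    using finV M A by (intro card_high_degree_le) auto
  then have "D * card ?H \<le> 4 * n" using cardM by linarith
  then have "real (D * card ?H) \<le> real (4 * n)"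
    by (simp only: of_nat_le_iff)
  then have "real D * card ?H \<le> 4 * real n" by simp
  \<comment> \<open>With \<open>D * \<beta> \<ge> 8\<close> this bounds the vertices of high degree
    by \<open>\<beta> * n / 2\<close>, so at least half of the guaranteed \<open>\<beta> * n\<close>
    vertices survive in \<open>U\<close>.\<close>
  then have "\<beta> * (real D * card ?H) \<le> \<beta> * (4 * real n)"
    using \<beta> by simp
  moreover have "8 * real (card ?H) \<le> (D * \<beta>) * card ?H"
    using D by (intro mult_right_mono) auto
  ultimately have "2 * real (card ?H) \<le> \<beta> * n"
    by (simp add: algebra_simps)
  moreover have "card (V - T) = card U + card ?H"
  proof -
    have split: "V - T = U \<union> ?H" and "U \<inter> ?H = {}" by (auto simp: U_def)
    moreover have "finite U" "finite ?H" using finV by (auto simp: U_def)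
    ultimately show ?thesis by (subst split) (rule card_Un_disjoint)
  qed
  ultimately have cardU: "2 * real (card U) \<ge> \<beta> * n"
    using VT by linarith
  have UV: "U \<subseteq> V" "U \<inter> T = {}" by (auto simp: U_def)
  obtain W where W: "W \<subseteq> U" "card U \<le> card W * (D * 4 + 1)"
    and conflict: "\<And>i v w. i \<in> M \<Longrightarrow> v \<in> W \<Longrightarrow> w \<in> W \<Longrightarrow> v \<in> A i \<Longrightarrow> w \<in> A i \<Longrightarrow> v = w"
  proof -
    have "finite U" using UV finV finite_subset by blast
    moreover have "finite {i \<in> M. v \<in> A i} \<and> card {i \<in> M. v \<in> A i} \<le> D" if "v \<in> U" for v
      using that M by (auto simp: U_def)
    ultimately show ?thesis
      using exists_conflict_free_subset[of U M A 4 D] A that by blast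
  qed
  have "real (card U) \<le> real (card W) * (4 * real D + 1)"
  proof -
    have "real (card U) \<le> real (card W * (D * 4 + 1))" using W by (simp only: of_nat_le_iff)
    then show ?thesis by (simp add: algebra_simps)
  qed
  then have size: "real (card W) * (2 * (4 * real D + 1)) \<ge> \<beta> * n"
    using cardU by (simp add: algebra_simps)
  \<comment> \<open>Outside \<open>M\<close> the edge \<open>g i\<close> lies in \<open>T\<close>.
    In \<open>M\<close>, if both edges met \<open>W\<close>, their disjointness would give two
    different vertices of \<open>W\<close> on color \<open>i\<close>.\<close>
  have "\<exists>e\<in>F i. e \<inter> W = {}" if i: "i \<in> {1..n}" for i
  proof (cases "i \<in> M")
    case False
    then have "g i \<inter> W = {}" using i W(1) UV(2) unfolding T_def by blast
    then show ?thesis using g[OF i] by blast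
  next
    case True
    then obtain e f where ef: "F i = {e, f}" "e \<noteq> f" "e \<inter> f = {}"
      by (auto simp: M_def card_2_iff matching_def)
    show ?thesis
    proof (rule ccontr)
      assume "\<not> ?thesis"
      then obtain v w where "v \<in> e" "v \<in> W" "w \<in> f" "w \<in> W"
        using ef by auto
      with conflict[OF True, of v w] ef show False
        by (auto simp: A_def)
    qed
  qed
  then obtain h where "\<And>i. i \<in> {1..n} \<Longrightarrow> h i \<in> F i \<and> h i \<inter> W = {}"
    by metis
  then show ?thesis
    using W UV size by blast
qed

section \<open>From the dense rainbow graph to logarithmic rainbow girth\<close>

theorem theorem5:
  fixes \<alpha> :: real
  assumes "\<alpha> > 1/2"
  shows "\<exists>C::real. \<forall>(n::nat) (V :: 'a set) (E :: 'a set set) (F :: nat \<Rightarrow> 'a set set).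
           n > 0 \<longrightarrow> simple_graph V E \<longrightarrow> card V = n \<longrightarrow> edge_coloring E n F \<longrightarrow>
           real (card {i\<in>{1..n}. matching (F i) \<and> card (F i) = 2}) \<ge> \<alpha> * real n \<longrightarrow>
           ereal_of_enat (rgirth V E n F) \<le> ereal (C * ln (real n))"
proof -
  define \<beta> where "\<beta> = 2 * \<alpha> - 1"
  define D where "D = nat \<lceil>8 / \<beta>\<rceil>"
  define c where "c = \<beta> / (2 * (4 * real D + 1))"
  \<comment> \<open>A cycle length of at most \<open>2 * K + 1\<close> becomes
    \<open>2 * ln n / ln (1 + c) + 3\<close>; the summand 3 is absorbed using
    \<open>ln n \<ge> 1\<close>.\<close>
  define C where "C = 2 / ln (1 + c) + 3"
  have \<beta>: "\<beta> > 0" using assms by (simp add: \<beta>_def)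
  have "real D \<ge> 8 / \<beta>" by (simp add: D_def real_nat_ceiling_ge)
  then have D: "D * \<beta> \<ge> 8" using \<beta> by (simp add: divide_simps mult.commute)
  have c: "c > 0" using \<beta> by (simp add: c_def add_nonneg_pos)
  show ?thesis
  proof (intro exI[of _ C] allI impI)
    fix n :: nat and V :: "'a set" and E :: "'a set set" and F :: "nat \<Rightarrow> 'a set set"
    assume n: "n > 0" and graph: "simple_graph V E" and V: "card V = n"
      and coloring: "edge_coloring E n F"
      and many: "real (card {i\<in>{1..n}. matching (F i) \<and> card (F i) = 2}) \<ge> \<alpha> * real n"
    obtain W h where W: "W \<subseteq> V" "real (card W) * (2 * (4 * real D + 1)) \<ge> \<beta> * n"
      and h: "\<And>i. i \<in> {1..n} \<Longrightarrow> h i \<in> F i" "\<And>i. i \<in> {1..n} \<Longrightarrow> h i \<inter> W = {}"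
      using exists_rainbow_choice[OF graph V coloring many \<beta>_def \<beta> D] by blast
    have finV: "finite V" and E: "\<And>e. e \<in> E \<Longrightarrow> e \<subseteq> V \<and> card e = 2"
      using graph by (auto simp: simple_graph_def)
    have disj: "F i \<inter> F j = {}" if "i \<in> {1..n}" "j \<in> {1..n}" "i \<noteq> j" for i j
      using coloring that by (auto simp: edge_coloring_def disjoint_family_on_def)
    have hE: "h i \<in> E" if "i \<in> {1..n}" for i
      using coloring h(1)[OF that] that by (auto simp: edge_coloring_def)
    \<comment> \<open>Disjoint color classes keep the chosen edges distinct, so \<open>H\<close> has
      exactly \<open>n\<close> edges.\<close>
    have "inj_on h {1..n}"
      using disj h(1) by (metis disjoint_iff inj_onI)
    define H where "H = h ` {1..n}"
    have cardH: "card H = n"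
      using \<open>inj_on h {1..n}\<close> by (simp add: H_def card_image)
    have edges: "e \<subseteq> V - W \<and> card e = 2" if "e \<in> H" for e
      using that E hE h(2) unfolding H_def by blast
    have "V - W \<noteq> {}"
    proof -
      have "h 1 \<in> H" using n by (auto simp: H_def)
      from edges[OF this] show ?thesis
        by (metis card.empty subset_empty zero_neq_numeral)
    qed
    have "real (card W) \<ge> c * n"
      using W(2) by (simp add: c_def field_simps add_nonneg_pos)
    moreover have "real (card (V - W)) = real n - card W"
      using W(1) finV V by (metis card_Diff_subset card_mono finite_subset of_nat_diff)
    \<comment> \<open>The same \<open>c\<close> serves as vertex deficit and as edge excess, because
      \<open>(1 + c) * (1 - c) \<le> 1\<close>.\<close>
    ultimately have "(1 + c) * card (V - W) \<le> (1 + c) * ((1 - c) * n)"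
      using c by (intro mult_left_mono) (auto simp: algebra_simps)
    also have "\<dots> = n - c\<^sup>2 * n"
      by (simp add: algebra_simps power2_eq_square)
    also have "\<dots> \<le> card H" by (simp add: cardH)
    finally have dense: "real (card H) \<ge> (1 + c) * card (V - W)" .
    \<comment> \<open>The least exponent with \<open>(1 + c) ^ K > n\<close>; the successor of the
      floor keeps the inequality strict when the quotient is an integer.\<close>
    define K where "K = Suc (nat \<lfloor>ln n / ln (1 + c)\<rfloor>)"
    have lnc: "ln (1 + c) > 0" using c by simp
    have "0 \<le> ln n / ln (1 + c)" using n lnc by simp
    then have K: "ln n / ln (1 + c) < K" "K \<le> ln n / ln (1 + c) + 1"
      unfolding K_def by linarith+
    have "ln n < K * ln (1 + c)" using K(1) lnc by (simp add: divide_simps)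
    then have "ln n < ln ((1 + c) ^ K)" using c by (simp add: ln_realpow)
    then have "n < (1 + c) ^ K" using n c by simp
    moreover have "card (V - W) \<le> n" using V finV by (metis Diff_subset card_mono)
    ultimately have big: "(1 + c) ^ K > card (V - W)" by linarith
    obtain vs where vs: "is_cycle (V - W) H vs" "length vs \<le> 2 * K + 1"
      using short_cycle_if_excess_edges[OF _ \<open>V - W \<noteq> {}\<close> edges dense c big] finV by blast
    have "is_cycle V E vs"
      by (rule is_cycle_mono[OF vs(1)]) (use hE in \<open>auto simp: H_def\<close>)
    moreover have "rainbow n F (cycle_edges vs)"
      unfolding rainbow_def
    proof
      fix i assume i: "i \<in> {1..n}"
      have "cycle_edges vs \<subseteq> H" using vs(1) by (simp add: is_cycle_def)
      moreover have "H \<inter> F i \<subseteq> {h i}"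
        using disj h(1) i unfolding H_def by blast
      ultimately have "cycle_edges vs \<inter> F i \<subseteq> {h i}" by blast
      then show "card (cycle_edges vs \<inter> F i) \<le> 1"
        using card_mono[of "{h i}"] by fastforce
    qed
    ultimately have "rgirth V E n F \<le> enat (length vs)"
      unfolding rgirth_def by (intro Inf_lower) blast
    then have "ereal_of_enat (rgirth V E n F) \<le> ereal_of_enat (enat (length vs))"
      by (simp only: ereal_of_enat_le_iff)
    then have girth: "ereal_of_enat (rgirth V E n F) \<le> ereal (length vs)"
      by simp
    \<comment> \<open>The cycle itself rules out \<open>n < 3\<close>, so
      \<open>ln n \<ge> 1\<close> since \<open>exp 1 \<le> 3\<close>.\<close>
    have "3 \<le> length vs" "distinct vs" "set vs \<subseteq> V"
      using \<open>is_cycle V E vs\<close> by (auto simp: is_cycle_def)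
    then have "3 \<le> n"
      using V finV by (metis card_mono distinct_card le_trans)
    then have "1 \<le> ln n"
      using exp_le n by (subst ln_ge_iff) auto
    have "real (length vs) \<le> 2 * K + 1" using vs(2) by linarith
    also have "\<dots> \<le> 2 * (ln n / ln (1 + c)) + 3" using K(2) by linarith
    also have "\<dots> \<le> C * ln n"
      using \<open>1 \<le> ln n\<close> by (simp add: C_def algebra_simps)
    finally show "ereal_of_enat (rgirth V E n F) \<le> ereal (C * ln n)"
      using girth by (meson ereal_less_eq(3) order_trans)
  qed
qed

end
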